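(* Let $G$ be a simple connected graph of order $n=|V(G)|\geq 3$. Then $$\lambda(G)\leq \partial(R(G))\leq \lambda(G)+\left\lfloor\frac{|V(G)|-\mu(G)}{2}\right\rfloor,$$ where $\lambda(G)=|E(G)|-|V(G)|+2\alpha(G)$ and $\mu(G)$ is the maximum cardinality of a differential set of $R(G)$ contained in $V(G)$.
   Context: $R(G)$ is the graph obtained from $G$ by adding, for each edge $e=xy\in E(G)$, a new vertex $v_e$ adjacent exactly to $x$ and $y$; thus $V(G)\subseteq V(R(G))$. For a graph $H$ and $S\subseteq V(H)$, $N_H(S)$ is the set of vertices adjacent to some vertex of $S$, $B_H(S)=N_H(S)\setminus S$, and the differential of $S$ is $\partial_H(S)=|B_H(S)|-|S|$. The differential of $H$ is $\partial(H)=\max\{\partial_H(S): S\subseteq V(H)\}$, and $S$ is a differential set of $H$ if $\partial_H(S)=\partial(H)$. $\alpha(G)$ is the independence number of $G$. *)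

theory Defs
  imports Complex_Main
begin

datatype 'a graph = Graph (verts: "'a set") (edges: "'a set set")

definition simple_graph :: "'a graph \<Rightarrow> bool" where
  "simple_graph G \<longleftrightarrow> finite (verts G) \<and> (\<forall>e\<in>edges G. e \<subseteq> verts G \<and> card e = 2)"

definition adj :: "'a graph \<Rightarrow> 'a \<Rightarrow> 'a \<Rightarrow> bool" where
  "adj G x y \<longleftrightarrow> {x, y} \<in> edges G"

definition connected_graph :: "'a graph \<Rightarrow> bool" where
  "connected_graph G \<longleftrightarrow>
    verts G \<noteq> {} \<and> (\<forall>x\<in>verts G. \<forall>y\<in>verts G. (adj G)\<^sup>*\<^sup>* x y)"

definition independent_set :: "'a graph \<Rightarrow> 'a set \<Rightarrow> bool" where
  "independent_set G S \<longleftrightarrow> S \<subseteq> verts G \<and> (\<forall>x\<in>S. \<forall>y\<in>S. \<not> adj G x y)"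

definition independence_number :: "'a graph \<Rightarrow> nat" where
  "independence_number G = Max {card S |S. independent_set G S}"

definition neighbours :: "'a graph \<Rightarrow> 'a set \<Rightarrow> 'a set" where
  "neighbours H S = {v \<in> verts H. \<exists>u\<in>S. adj H u v}"

definition boundary :: "'a graph \<Rightarrow> 'a set \<Rightarrow> 'a set" where
  "boundary H S = neighbours H S - S"

definition set_differential :: "'a graph \<Rightarrow> 'a set \<Rightarrow> int" where
  "set_differential H S = int (card (boundary H S)) - int (card S)"

definition differential :: "'a graph \<Rightarrow> int" where
  "differential H = Max {set_differential H S |S. S \<subseteq> verts H}"

definition differential_set :: "'a graph \<Rightarrow> 'a set \<Rightarrow> bool" where
  "differential_set H S \<longleftrightarrow> S \<subseteq> verts H \<and> set_differential H S = differential H"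

text \<open>In \<open>R_graph G\<close> an original vertex \<open>x\<close> is \<open>Inl x\<close> and the new vertex of an edge
  \<open>e\<close> is \<open>Inr e\<close>. So \<open>V(G)\<close>, as a subset of \<open>V(R(G))\<close>, is \<open>Inl ` verts G\<close>.\<close>

definition R_graph :: "'a graph \<Rightarrow> ('a + 'a set) graph" where
  "R_graph G = Graph (Inl ` verts G \<union> Inr ` edges G)
    ({{Inl x, Inl y} |x y. {x, y} \<in> edges G} \<union> {{Inl x, Inr e} |x e. e \<in> edges G \<and> x \<in> e})"

definition lambda_number :: "'a graph \<Rightarrow> int" where
  "lambda_number G =
    int (card (edges G)) - int (card (verts G)) + 2 * int (independence_number G)"

definition mu_number :: "'a graph \<Rightarrow> nat" where
  "mu_number G = Max {card S |S. differential_set (R_graph G) S \<and> S \<subseteq> Inl ` verts G}"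

end

theory Submission imports Defs begin

text \<open>For \<open>A \<subseteq> V(G)\<close>, the differential of \<open>A\<close> in \<open>R(G)\<close> is
  \<open>|B\<^sub>G(A)| + |{e. e meets A}| - |A|\<close>. The complement of a maximum independent set has value
  \<open>\<lambda>(G)\<close>, which is the lower bound. For the upper bound, exchanging a new vertex \<open>v\<^sub>e\<close> for an
  end of \<open>e\<close> never decreases the differential, so differential sets inside \<open>V(G)\<close> exist; let \<open>A\<close>
  be one of maximum size and \<open>D = V(G) - A\<close>. A vertex lying on two edges inside \<open>D\<close> could be added
  to \<open>A\<close> without loss, hence the edges inside \<open>D\<close> form a matching. There are at most \<open>|D|/2\<close> of
  them, and deleting one end of each leaves an independent set.\<close>

section \<open>Simple graphs and the independence number\<close>

lemma finite_edges: "simple_graph G \<Longrightarrow> finite (edges G)"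
  unfolding simple_graph_def by (rule finite_subset[of _ "Pow (verts G)"]) auto

lemma adj_commute: "adj G x y \<longleftrightarrow> adj G y x"
  by (simp add: adj_def insert_commute)

lemma adj_irrefl: "simple_graph G \<Longrightarrow> \<not> adj G x x"
  unfolding simple_graph_def adj_def by fastforce

lemma adj_verts: "simple_graph G \<Longrightarrow> adj G x y \<Longrightarrow> x \<in> verts G \<and> y \<in> verts G"
  unfolding simple_graph_def adj_def by blast

lemma edgeE:
  assumes "simple_graph G" "e \<in> edges G"
  obtains x y where "e = {x, y}" "x \<noteq> y"
  using assms unfolding simple_graph_def by (metis card_2_iff)

lemma finite_independence: "simple_graph G \<Longrightarrow> finite {card S |S. independent_set G S}"
  by (rule finite_subset[of _ "card ` Pow (verts G)"])
    (auto simp: simple_graph_def independent_set_def)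

lemma card_le_independence_number:
  assumes "simple_graph G" "independent_set G S"
  shows "card S \<le> independence_number G"
  unfolding independence_number_def
  by (rule Max_ge) (use assms finite_independence in auto)

lemma independence_number_attained:
  assumes "simple_graph G"
  obtains S where "independent_set G S" "card S = independence_number G"
proof -
  have "independent_set G {}"
    by (simp add: independent_set_def)
  then have "independence_number G \<in> {card S |S. independent_set G S}"
    unfolding independence_number_def by (intro Max_in finite_independence assms) auto
  then show thesis using that by auto
qed

text \<open>There is a second vertex \<open>z\<close>, and the first edge of a walk from
  \<open>x\<close> to \<open>z\<close> supplies the neighbour.\<close>

lemma connected_neighbour:
  assumes "connected_graph G" "card (verts G) \<ge> 2" "x \<in> verts G"
  obtains y where "adj G x y"
proof -
  have "\<not> verts G \<subseteq> {x}"
    using assms(2) card_mono[of "{x}" "verts G"] by auto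
  then obtain z where "z \<in> verts G" "z \<noteq> x" by blast
  then have "(adj G)\<^sup>*\<^sup>* x z" "z \<noteq> x"
    using assms unfolding connected_graph_def by auto
  then show thesis using that by (metis converse_rtranclpE)
qed

text \<open>Deleting one chosen end of every edge inside \<open>D\<close> destroys all these edges,
  so an independent set remains. At most one vertex is lost per edge; edges may share a chosen end,
  which only helps.\<close>

lemma independent_set_delete_ends:
  assumes "simple_graph G" "D \<subseteq> verts G"
  shows "card D \<le> independence_number G + card {e \<in> edges G. e \<subseteq> D}"
proof -
  let ?F = "{e \<in> edges G. e \<subseteq> D}"
  \<comment> \<open>An arbitrary end of \<open>e\<close>: which one is deleted is
    irrelevant.\<close>
  define f where "f e = (SOME x. x \<in> e)" for e :: "'a set"
  have f: "f e \<in> e" if e: "e \<in> edges G" for e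
  proof -
    obtain x y where "e = {x, y}" using edgeE[OF assms(1) e] .
    then have "x \<in> e" by simp
    then show ?thesis unfolding f_def by (rule someI)
  qed
  have fin: "finite ?F" "finite D"
    using assms finite_edges[of G] by (auto simp: simple_graph_def intro: finite_subset)
  have "independent_set G (D - f ` ?F)"
    unfolding independent_set_def
  proof (intro conjI ballI notI)
    fix x y assume xy: "x \<in> D - f ` ?F" "y \<in> D - f ` ?F" "adj G x y"
    then have "{x, y} \<in> ?F" by (auto simp: adj_def)
    moreover from this have "f {x, y} \<in> {x, y}" using f[of "{x, y}"] by simp
    moreover have "f {x, y} \<noteq> x" "f {x, y} \<noteq> y"
      using xy(1,2) \<open>{x, y} \<in> ?F\<close> by (metis DiffD2 imageI)+
    ultimately show False by simp
  qed (use assms in auto)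
  then have "card (D - f ` ?F) \<le> independence_number G"
    by (rule card_le_independence_number[OF assms(1)])
  moreover have "card D - card (f ` ?F) \<le> card (D - f ` ?F)"
    using fin by (intro diff_card_le_card_Diff) auto
  moreover have "card (f ` ?F) \<le> card ?F"
    using fin by (intro card_image_le)
  ultimately show ?thesis by linarith
qed

section \<open>Differentials in R(G)\<close>

lemma verts_R_graph: "verts (R_graph G) = Inl ` verts G \<union> Inr ` edges G"
  by (simp add: R_graph_def)

lemma adj_R_graph [simp]:
  "adj (R_graph G) (Inl x) (Inl y) \<longleftrightarrow> adj G x y"
  "adj (R_graph G) (Inl x) (Inr e) \<longleftrightarrow> e \<in> edges G \<and> x \<in> e"
  "adj (R_graph G) (Inr e) (Inl x) \<longleftrightarrow> e \<in> edges G \<and> x \<in> e"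
  "\<not> adj (R_graph G) (Inr e) (Inr e')"
  by (auto simp: adj_def R_graph_def doubleton_eq_iff insert_commute)

lemma finite_verts_R_graph: "simple_graph G \<Longrightarrow> finite (verts (R_graph G))"
  by (simp add: verts_R_graph finite_edges) (simp add: simple_graph_def)

lemma boundary_subset_verts: "boundary H S \<subseteq> verts H"
  by (auto simp: boundary_def neighbours_def)

lemma finite_differentials:
  "finite (verts H) \<Longrightarrow> finite {set_differential H S |S. S \<subseteq> verts H}"
  by (rule finite_subset[of _ "set_differential H ` Pow (verts H)"]) auto

lemma set_differential_le_differential:
  assumes "finite (verts H)" "S \<subseteq> verts H"
  shows "set_differential H S \<le> differential H"
  unfolding differential_def
  by (rule Max_ge) (use assms finite_differentials in auto)

lemma differential_set_exists:
  assumes "finite (verts H)"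
  obtains S where "differential_set H S"
proof -
  have "differential H \<in> {set_differential H S |S. S \<subseteq> verts H}"
    unfolding differential_def by (intro Max_in finite_differentials assms) auto
  then show thesis using that by (auto simp: differential_set_def)
qed

text \<open>The boundary splits by vertex type: an original vertex is reached along an edge of
  \<open>G\<close>, and the new vertex of \<open>e\<close> is reached exactly when \<open>e\<close>
  meets \<open>A\<close>. This turns both bounds into counting in \<open>G\<close>.\<close>

lemma set_differential_R_graph_Inl:
  assumes "simple_graph G" "A \<subseteq> verts G"
  shows "set_differential (R_graph G) (Inl ` A) =
    int (card (boundary G A)) + int (card {e \<in> edges G. e \<inter> A \<noteq> {}}) - int (card A)"
proof -
  have eq: "boundary (R_graph G) (Inl ` A) =
      Inl ` boundary G A \<union> Inr ` {e \<in> edges G. e \<inter> A \<noteq> {}}"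
  proof (rule set_eqI)
    fix v :: "'a + 'a set"
    show "v \<in> boundary (R_graph G) (Inl ` A) \<longleftrightarrow>
        v \<in> Inl ` boundary G A \<union> Inr ` {e \<in> edges G. e \<inter> A \<noteq> {}}"
      by (cases v) (auto simp: boundary_def neighbours_def verts_R_graph image_iff)
  qed
  have "finite (boundary G A)"
    using assms boundary_subset_verts by (metis finite_subset simple_graph_def)
  moreover have "finite {e \<in> edges G. e \<inter> A \<noteq> {}}"
    using finite_edges[OF assms(1)] by simp
  ultimately have "card (boundary (R_graph G) (Inl ` A)) =
      card (boundary G A) + card {e \<in> edges G. e \<inter> A \<noteq> {}}"
    unfolding eq by (subst card_Un_disjoint) (auto simp: card_image)
  then show ?thesis
    by (simp add: set_differential_def card_image)
qed

text \<open>After the exchange the new vertex of \<open>e\<close> enters the boundary, and at most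
  \<open>Inl x\<close> leaves it: the only other neighbour of the new vertex is the second end
  \<open>y\<close> of \<open>e\<close>, which is adjacent to \<open>x\<close>. The set does not
  grow, and it shrinks if \<open>Inl x\<close> was already in \<open>T\<close>.\<close>

lemma R_graph_exchange:
  assumes "simple_graph G" "T \<subseteq> verts (R_graph G)" "Inr e \<in> T" "x \<in> e"
  shows "set_differential (R_graph G) T
    \<le> set_differential (R_graph G) (insert (Inl x) (T - {Inr e}))"
proof -
  let ?T' = "insert (Inl x) (T - {Inr e})"
  let ?B = "boundary (R_graph G)"
  have e: "e \<in> edges G" using assms(2,3) by (auto simp: verts_R_graph)
  have fin: "finite (?B S)" for S
    by (rule finite_subset[OF boundary_subset_verts finite_verts_R_graph[OF assms(1)]])
  have finT: "finite T"
    using assms(1,2) finite_subset finite_verts_R_graph by blast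
  obtain y where y: "e = {x, y}" "x \<noteq> y"
    using edgeE[OF assms(1) e] assms(4) by (metis insert_commute insertE singletonD)
  have "insert (Inr e) (?B T - {Inl x}) \<subseteq> ?B ?T'"
  proof
    fix v assume v: "v \<in> insert (Inr e) (?B T - {Inl x})"
    show "v \<in> ?B ?T'"
    proof (cases "v = Inr e")
      case True
      then show ?thesis
        using e assms(4) by (auto simp: boundary_def neighbours_def verts_R_graph)
    next
      case False
      with v obtain u where u: "v \<in> verts (R_graph G)" "u \<in> T" "adj (R_graph G) u v"
          "v \<notin> T" "v \<noteq> Inl x"
        by (auto simp: boundary_def neighbours_def)
      have "\<exists>u' \<in> ?T'. adj (R_graph G) u' v"
      proof (cases "u = Inr e")
        case True
        then have "v = Inl y" using u y by (cases v) auto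
        moreover have "adj G x y" using e y by (simp add: adj_def)
        ultimately show ?thesis by simp
      qed (use u in blast)
      then show ?thesis using u by (simp add: boundary_def neighbours_def)
    qed
  qed
  then have "card (insert (Inr e) (?B T - {Inl x})) \<le> card (?B ?T')"
    by (intro card_mono fin)
  moreover have "Inr e \<notin> ?B T" using assms(3) by (simp add: boundary_def)
  \<comment> \<open>\<open>Inr e\<close> was not in the old boundary, so it makes up for the
    possible loss of \<open>Inl x\<close>.\<close>
  then have "card (insert (Inr e) (?B T - {Inl x})) \<ge> card (?B T)"
    using fin[of T] diff_card_le_card_Diff[of "{Inl x}" "?B T"] by simp
  moreover have "card ?T' \<le> card T"
    using finT assms(3) by (intro card_insert_le_m1) (auto simp: card_gt_0_iff)
  ultimately show ?thesis by (simp add: set_differential_def)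
qed

text \<open>Each exchange keeps the differential maximal and removes one new vertex from the set, so
  repeating it ends inside the original vertices.\<close>

lemma differential_set_in_verts_exists:
  assumes "simple_graph G"
  obtains A where "A \<subseteq> verts G" "differential_set (R_graph G) (Inl ` A)"
proof -
  let ?H = "R_graph G"
  have "\<exists>A \<subseteq> verts G. differential_set ?H (Inl ` A)" if "differential_set ?H T" for T
    using that
  proof (induction "card (T \<inter> range Inr)" arbitrary: T rule: less_induct)
    case less
    then have T: "T \<subseteq> verts ?H" "set_differential ?H T = differential ?H"
      by (auto simp: differential_set_def)
    show ?case
    proof (cases "\<exists>e. Inr e \<in> T")
      case False
      then have "T \<subseteq> Inl ` verts G" using T by (auto simp: verts_R_graph)
      then show ?thesis using less.prems by (metis subset_image_iff)
    next
      case True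
      then obtain e where e: "Inr e \<in> T" by blast
      then have "e \<in> edges G" using T by (auto simp: verts_R_graph)
      then obtain x where x: "x \<in> e" "x \<in> verts G"
        using assms edgeE[OF assms] unfolding simple_graph_def by (metis insertI1 subsetD)
      let ?T' = "insert (Inl x) (T - {Inr e})"
      have "?T' \<subseteq> verts ?H" using T x by (auto simp: verts_R_graph)
      moreover have "differential ?H \<le> set_differential ?H ?T'"
        using R_graph_exchange[OF assms T(1) e x(1)] T(2) by simp
      ultimately have "differential_set ?H ?T'"
        using set_differential_le_differential[OF finite_verts_R_graph[OF assms], of ?T']
        by (simp add: differential_set_def)
      moreover have "card (?T' \<inter> range Inr) < card (T \<inter> range Inr)"
        using e finite_subset[OF T(1) finite_verts_R_graph[OF assms]]
        by (intro psubset_card_mono) auto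
      ultimately show ?thesis using less.hyps by blast
    qed
  qed
  then show thesis
    using that differential_set_exists[OF finite_verts_R_graph[OF assms]] by metis
qed

text \<open>The maximum defining \<open>mu_number G\<close> is over a finite set, nonempty by the
  previous lemma, and is therefore attained. The sets are given as subsets of
  \<open>verts G\<close>, since \<open>Inl\<close> preserves cardinality.\<close>

lemma mu_number_attained:
  assumes "simple_graph G"
  obtains A where "A \<subseteq> verts G" "differential_set (R_graph G) (Inl ` A)"
    "card A = mu_number G"
    "\<And>A'. A' \<subseteq> verts G \<Longrightarrow> differential_set (R_graph G) (Inl ` A') \<Longrightarrow> card A' \<le> mu_number G"
proof -
  let ?M = "{card S |S. differential_set (R_graph G) S \<and> S \<subseteq> Inl ` verts G}"
  have fin: "finite ?M"
    by (rule finite_subset[of _ "card ` Pow (Inl ` verts G)"])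
      (use assms in \<open>auto simp: simple_graph_def\<close>)
  obtain A0 where "A0 \<subseteq> verts G" "differential_set (R_graph G) (Inl ` A0)"
    using differential_set_in_verts_exists[OF assms] .
  then have "card (Inl ` A0 :: ('a + 'a set) set) \<in> ?M" by blast
  then have "?M \<noteq> {}" by blast
  then have "mu_number G \<in> ?M"
    unfolding mu_number_def using fin by (intro Max_in)
  then obtain S where S: "differential_set (R_graph G) S" "S \<subseteq> Inl ` verts G"
      "card S = mu_number G"
    by auto
  then obtain A where "A \<subseteq> verts G" "S = Inl ` A"
    by (meson subset_imageE)
  with S have "A \<subseteq> verts G" "differential_set (R_graph G) (Inl ` A)" "card A = mu_number G"
    by (simp_all add: card_image)
  moreover have "card A' \<le> mu_number G"
    if "A' \<subseteq> verts G" "differential_set (R_graph G) (Inl ` A')" for A' :: "'a set"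
  proof -
    have "card (Inl ` A' :: ('a + 'a set) set) \<in> ?M" using that by blast
    then show ?thesis
      using Max_ge[OF fin] by (simp add: mu_number_def card_image)
  qed
  ultimately show thesis by (rule that)
qed

section \<open>The lower bound\<close>

lemma lambda_number_le_differential:
  assumes "simple_graph G" "connected_graph G" "card (verts G) \<ge> 2"
  shows "lambda_number G \<le> differential (R_graph G)"
proof -
  obtain I where I: "independent_set G I" "card I = independence_number G"
    using independence_number_attained[OF assms(1)] .
  have fin: "finite (verts G)" using assms(1) by (simp add: simple_graph_def)
  have sub: "I \<subseteq> verts G" using I by (simp add: independent_set_def)
  let ?A = "verts G - I"
  \<comment> \<open>Every vertex of \<open>I\<close> has a neighbour, and by independence this
    neighbour lies outside \<open>I\<close>.\<close>
  have "I \<subseteq> boundary G ?A"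
  proof
    fix x assume x: "x \<in> I"
    then obtain y where y: "adj G x y"
      using connected_neighbour[OF assms(2,3)] sub by blast
    then have "y \<in> ?A"
      using I(1) x adj_verts[OF assms(1) y] by (auto simp: independent_set_def)
    then show "x \<in> boundary G ?A"
      using x y sub by (auto simp: boundary_def neighbours_def adj_commute[of G x])
  qed
  then have "boundary G ?A = I"
    by (auto simp: boundary_def neighbours_def)
  moreover have "e \<inter> ?A \<noteq> {}" if e: "e \<in> edges G" for e
  proof -
    obtain x y where xy: "e = {x, y}" using edgeE[OF assms(1) e] .
    then have "adj G x y" using e by (simp add: adj_def)
    then show ?thesis
      using xy I(1) adj_verts[OF assms(1)] unfolding independent_set_def by blast
  qed
  then have "{e \<in> edges G. e \<inter> ?A \<noteq> {}} = edges G" by blast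
  moreover have "int (card ?A) = int (card (verts G)) - int (card I)"
    using sub fin by (simp add: card_Diff_subset finite_subset card_mono of_nat_diff)
  ultimately have "set_differential (R_graph G) (Inl ` ?A) = lambda_number G"
    using I(2) by (simp add: set_differential_R_graph_Inl[OF assms(1)] lambda_number_def)
  then show ?thesis
    using set_differential_le_differential[OF finite_verts_R_graph[OF assms(1)], of "Inl ` ?A"]
    by (auto simp: verts_R_graph)
qed

section \<open>The upper bound\<close>

text \<open>Adding \<open>v\<close> gains at least the two edges \<open>e\<close> and
  \<open>e'\<close>. It costs at most one boundary vertex, namely \<open>v\<close> itself, and one
  for the larger set, so the balance is nonnegative.\<close>

lemma set_differential_add_vertex:
  assumes "simple_graph G" "A \<subseteq> verts G" "e \<in> edges G" "e' \<in> edges G" "e \<noteq> e'"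
    "e \<inter> A = {}" "e' \<inter> A = {}" "v \<in> e" "v \<in> e'"
  shows "set_differential (R_graph G) (Inl ` A) \<le> set_differential (R_graph G) (Inl ` insert v A)"
proof -
  let ?E = "\<lambda>A. {e \<in> edges G. e \<inter> A \<noteq> {}}"
  have fin: "finite (verts G)" "finite (edges G)"
    using assms(1) finite_edges by (auto simp: simple_graph_def)
  have v: "v \<in> verts G" "v \<notin> A"
    using assms by (auto simp: simple_graph_def)
  have finB: "finite (boundary G S)" for S
    using finite_subset[OF boundary_subset_verts fin(1)] .
  have "card (insert e (insert e' (?E A))) \<le> card (?E (insert v A))"
    using fin assms by (intro card_mono) auto
  moreover have "card (insert e (insert e' (?E A))) = card (?E A) + 2"
    using fin assms by simp
  moreover have "card (boundary G A - {v}) \<le> card (boundary G (insert v A))"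
    by (intro card_mono finB) (auto simp: boundary_def neighbours_def)
  moreover have "card (boundary G A) \<le> card (boundary G A - {v}) + 1"
    using diff_card_le_card_Diff[of "{v}" "boundary G A"] by simp
  moreover have "card (insert v A) = card A + 1"
    using v assms(2) fin by (simp add: finite_subset)
  moreover have "insert v A \<subseteq> verts G" using v assms by blast
  ultimately show ?thesis
    unfolding set_differential_R_graph_Inl[OF assms(1,2)]
    by (subst set_differential_R_graph_Inl[OF assms(1)]) linarith+
qed

text \<open>Doubling keeps the estimate in the integers; the floor appears only in the
  theorem.\<close>

lemma differential_upper_bound:
  assumes "simple_graph G"
  shows "2 * differential (R_graph G)
    \<le> 2 * lambda_number G + (int (card (verts G)) - int (mu_number G))"
proof -
  obtain A where A: "A \<subseteq> verts G" "differential_set (R_graph G) (Inl ` A)"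
      "card A = mu_number G"
      and maximal: "\<And>A'. A' \<subseteq> verts G \<Longrightarrow> differential_set (R_graph G) (Inl ` A') \<Longrightarrow>
        card A' \<le> mu_number G"
    using mu_number_attained[OF assms] by blast
  have fin: "finite (verts G)" "finite (edges G)" "finite A"
    using assms A(1) finite_edges finite_subset by (auto simp: simple_graph_def)
  define D where "D = verts G - A"
  define F where "F = {e \<in> edges G. e \<subseteq> D}"
  have edge_sub: "e \<subseteq> verts G" "card e = 2" if "e \<in> edges G" for e
    using assms that by (auto simp: simple_graph_def)
  have cD: "card (verts G) = card A + card D"
    unfolding D_def using fin A(1) by (metis card_Diff_subset card_mono le_add_diff_inverse)
  have "pairwise disjnt F"
    unfolding pairwise_def disjnt_def
  proof (intro ballI impI, rule ccontr)
    fix e e' assume e: "e \<in> F" "e' \<in> F" "e \<noteq> e'" "e \<inter> e' \<noteq> {}"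
    then obtain v where v: "v \<in> e" "v \<in> e'" by blast
    have vD: "v \<in> verts G" "v \<notin> A" using v e by (auto simp: F_def D_def)
    have "set_differential (R_graph G) (Inl ` A)
        \<le> set_differential (R_graph G) (Inl ` insert v A)"
      by (rule set_differential_add_vertex[OF assms A(1) _ _ e(3) _ _ v])
        (use e in \<open>auto simp: F_def D_def\<close>)
    moreover have sub: "Inl ` insert v A \<subseteq> verts (R_graph G)"
      using vD A by (auto simp: verts_R_graph)
    \<comment> \<open>A differential at least the maximum equals it, so \<open>insert v A\<close>
      would be a larger differential set than \<open>A\<close>.\<close>
    ultimately have "differential_set (R_graph G) (Inl ` insert v A)"
      using A(2) set_differential_le_differential[OF finite_verts_R_graph[OF assms] sub]
      by (simp add: differential_set_def)
    then have "card (insert v A) \<le> card A"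
      using maximal[of "insert v A"] vD A by auto
    then show False using vD fin by simp
  qed
  then have "card (\<Union>F) = (\<Sum>e\<in>F. card e)"
    by (intro card_Union_disjoint) (auto simp: F_def D_def intro: finite_subset fin)
  also have "\<dots> = 2 * card F"
    by (simp add: F_def edge_sub)
  finally have "2 * card F \<le> card D"
    using card_mono[of D "\<Union>F"] fin by (auto simp: F_def D_def)
  moreover have "card D \<le> independence_number G + card F"
    unfolding F_def by (rule independent_set_delete_ends) (use assms in \<open>auto simp: D_def\<close>)
  \<comment> \<open>Edges lie within \<open>verts G\<close>, so an edge misses \<open>A\<close>
    exactly when it lies inside \<open>D\<close>.\<close>
  moreover have "{e \<in> edges G. e \<inter> A \<noteq> {}} = edges G - F"
    using edge_sub by (auto simp: F_def D_def)
  then have "int (card {e \<in> edges G. e \<inter> A \<noteq> {}}) = int (card (edges G)) - int (card F)"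
    using fin by (simp add: F_def card_Diff_subset card_mono of_nat_diff)
  moreover have "card (boundary G A) \<le> card D"
    by (rule card_mono) (use fin in \<open>auto simp: D_def boundary_def neighbours_def\<close>)
  moreover have "differential (R_graph G) =
      int (card (boundary G A)) + int (card {e \<in> edges G. e \<inter> A \<noteq> {}}) - int (card A)"
    using A(2) set_differential_R_graph_Inl[OF assms A(1)] by (simp add: differential_set_def)
  \<comment> \<open>Substituting \<open>card A + card D\<close> for \<open>card (verts G)\<close>
    leaves \<open>3 * card D \<le> 4 * independence_number G + 2 * card F\<close>. It follows from
    four times \<open>card D \<le> independence_number G + card F\<close> together with
    \<open>2 * card F \<le> card D\<close>.\<close>
  ultimately show ?thesis
    using cD A(3) unfolding lambda_number_def by simp
qed

theorem theorem3p3: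
  fixes G :: "'a graph"
  assumes "simple_graph G"
    and "connected_graph G"
    and "card (verts G) \<ge> 3"
  shows "lambda_number G \<le> differential (R_graph G) \<and>
    differential (R_graph G) \<le>
      lambda_number G + \<lfloor>(real (card (verts G)) - real (mu_number G)) / 2\<rfloor>"
proof
  show "lambda_number G \<le> differential (R_graph G)"
    using assms by (intro lambda_number_le_differential) auto
  \<comment> \<open>The floor is taken of a real quotient, so the integer bound is first cast to the
    reals; an integer below the quotient is then below its floor.\<close>
  have "real_of_int (2 * differential (R_graph G))
      \<le> of_int (2 * lambda_number G + (int (card (verts G)) - int (mu_number G)))"
    using differential_upper_bound[OF assms(1)] of_int_le_iff by blast
  then have "differential (R_graph G) - lambda_number G
      \<le> \<lfloor>(real (card (verts G)) - real (mu_number G)) / 2\<rfloor>"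
    by (simp add: le_floor_iff)
  then show "differential (R_graph G) \<le>
      lambda_number G + \<lfloor>(real (card (verts G)) - real (mu_number G)) / 2\<rfloor>"
    by linarith
qed

end
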